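(* Let $a,b,p,q$ be positive integers with $(a,p)=1$ and $(b,q)=1$, and let $$\mathbb{S}\mathbb{S}(x):={\sum_{mn\leq x}}^{\prime}mn\sin(2\pi na/p)\sin(2\pi mb/q).$$ Then for every $\epsilon>0$, as $x\to\infty$, $$\mathbb{S}\mathbb{S}(x)=O(x^{4/3+\epsilon}).$$
   Context: The sum ${\sum}^{\prime}_{mn\le x}$ runs over pairs of positive integers $m,n$ with $mn\le x$; the prime means that if $x$ is an integer, the terms with $mn=x$ are multiplied by $\tfrac12$. The implied constant may depend on $\epsilon,a,b,p,q$. *)

theory Defs
  imports Complex_Main "HOL-Library.Landau_Symbols"
begin

text \<open>The weight \<open>1/2\<close> on the pairs with \<open>m n = x\<close> renders the prime on the summation
  sign; such pairs exist only if \<open>x\<close> is an integer.\<close>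

definition SS :: "nat \<Rightarrow> nat \<Rightarrow> nat \<Rightarrow> nat \<Rightarrow> real \<Rightarrow> real" where
  "SS a b p q x =
     (\<Sum>(m, n) \<in> {(m, n). 0 < m \<and> 0 < n \<and> real (m * n) \<le> x}.
        (if real (m * n) = x then 1 / 2 else 1) *
        (real m * real n * sin (2 * pi * real n * real a / real p)
                         * sin (2 * pi * real m * real b / real q)))"

lemma finite_SS_index: "finite {(m, n). 0 < m \<and> 0 < n \<and> real (m * n) \<le> x}"
proof (rule finite_subset)
  show "{(m, n). 0 < m \<and> 0 < n \<and> real (m * n) \<le> x} \<subseteq> {..nat \<lfloor>x\<rfloor>} \<times> {..nat \<lfloor>x\<rfloor>}"
  proof clarify
    fix m n :: nat
    assume "0 < m" "0 < n" "real (m * n) \<le> x"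
    then have "m * n \<le> nat \<lfloor>x\<rfloor>" by (simp add: le_nat_floor)
    moreover have "m \<le> m * n" "n \<le> m * n" using \<open>0 < m\<close> \<open>0 < n\<close> by simp_all
    ultimately show "m \<in> {..nat \<lfloor>x\<rfloor>} \<and> n \<in> {..nat \<lfloor>x\<rfloor>}"
      unfolding atMost_iff by (blast intro: order_trans)
  qed
qed simp

end

theory Submission
  imports Defs "HOL-Analysis.Kronecker_Approximation_Theorem"
    "HOL-Analysis.Harmonic_Numbers" "HOL-Real_Asymp.Real_Asymp"
begin

text \<open>
  The exponent \<open>4/3 = 1 + 1/3\<close> is the exponent of Voronoi in the divisor problem, raised by \<open>1\<close>
  because of the weight \<open>m n\<close>. The proof is an elementary one in his style, by rational
  approximation instead of exponential sums.

  Write \<open>s n = sin (2 \<pi> n a / p)\<close> and \<open>t m = sin (2 \<pi> m b / q)\<close>; both are periodic with mean value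
  zero. The hyperbola method (\<open>sum_hyperbola\<close>) reduces the sum over \<open>m n \<le> N\<close> to sums over
  \<open>m \<le> \<surd>N\<close> of \<open>m t m\<close> times the sum of \<open>n s n\<close> over \<open>n \<le> N / m\<close>, and to the symmetric ones. As \<open>s\<close>
  has mean value zero, the inner sum has no main term: up to \<open>O(1)\<close> it equals \<open>- N / m\<close> times
  the sum of \<open>s j \<psi> ((N / m - j) / p)\<close> over \<open>j \<le> p\<close>, where \<open>\<psi> y = frac y - 1/2\<close>
  (\<open>abs_sum_mean_zero_weighted\<close>). The factor \<open>1 / m\<close> cancels the weight \<open>m\<close>. On each residue
  class of \<open>m\<close> modulo \<open>q\<close> one is left with \<open>N\<close> times a sum of \<open>\<psi> (X / (k + \<beta>) + \<gamma>)\<close> over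
  \<open>k = O(\<surd>X)\<close>, where \<open>X = N / (p q)\<close>.

  That sum is \<open>O(X\<^sup>1\<^sup>/\<^sup>3 log\<^sup>2 X)\<close> by \<open>abs_sum_sawtooth_hyperbola\<close>. The reason is that \<open>\<psi>\<close>, summed
  over \<open>l\<close> consecutive terms of an arithmetic progression of slope \<open>a / l\<close> in lowest terms, is
  bounded by \<open>1/2\<close> (\<open>sum_sawtooth_rational_line\<close>), and that this is stable under
  perturbations of size \<open>O(1 / l)\<close> (\<open>abs_sum_sawtooth_near_rational_line\<close>). So the range of
  summation is cut into blocks on which the function is close to such a progression, the
  slopes being Dirichlet approximations to the derivative. Each block contributes \<open>O(1)\<close>, and
  the number of blocks is bounded because the derivative is monotone and cannot stay close to
  one fraction for long (\<open>abs_sum_sawtooth_le_by_Dirichlet_blocks\<close>).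

  The result is a bound \<open>O(N\<^sup>4\<^sup>/\<^sup>3 log\<^sup>2 N)\<close>; the \<open>\<epsilon>\<close> absorbs the logarithms.
\<close>

section \<open>Sawtooth sums along nearly rational lines\<close>

definition sawtooth :: "real \<Rightarrow> real" where
  "sawtooth y = frac y - 1 / 2"

lemma abs_sawtooth_le: "\<bar>sawtooth y\<bar> \<le> 1 / 2"
  using frac_ge_0[of y] frac_lt_1[of y] unfolding sawtooth_def by linarith

text \<open>As \<open>h\<close> runs through a residue system, so does \<open>a h\<close>; hence the fractional parts are the
  points of one coset of \<open>(1/q)\<int>/\<int>\<close>, whose average is \<open>1/2\<close> up to the position of the
  coset. This is the distribution relation of the first Bernoulli function. The
  cancellation, \<open>q\<close> terms against a total of at most \<open>1/2\<close>, is the source of the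
  whole estimate.\<close>
lemma sum_sawtooth_rational_line:
  fixes a :: int and q :: nat and c :: real
  assumes "coprime a (int q)" and "q > 0"
  shows "(\<Sum>h<q. sawtooth (c + of_int a * real h / real q)) = sawtooth (real q * c)"
proof -
  define N where "N = \<lfloor>real q * c\<rfloor>"
  define \<theta> where "\<theta> = frac (real q * c)"
  define r where "r h = (N + a * int h) mod int q" for h :: nat
  have \<theta>: "0 \<le> \<theta>" "\<theta> < 1"
    unfolding \<theta>_def by (simp_all add: frac_lt_1)
  have c: "real q * c = of_int N + \<theta>"
    unfolding \<theta>_def N_def by (simp add: frac_def)
  have frac: "frac (c + of_int a * real h / real q) = (of_int (r h) + \<theta>) / real q" for h
  proof (subst frac_unique_iff, intro conjI)
    have "of_int (N + a * int h) = of_int ((N + a * int h) div int q * int q + r h)"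
      unfolding r_def by simp
    then have "of_int N + of_int a * real h
        = of_int ((N + a * int h) div int q) * real q + (of_int (r h) :: real)" by simp
    then have "real q * c + of_int a * real h
        = of_int ((N + a * int h) div int q) * real q + (of_int (r h) + \<theta>)" using c by simp
    then have "c + of_int a * real h / real q - (of_int (r h) + \<theta>) / real q
        = of_int ((N + a * int h) div int q)"
      using \<open>q > 0\<close> by (simp add: field_simps)
    then show "c + of_int a * real h / real q - (of_int (r h) + \<theta>) / real q \<in> \<int>"
      by simp
    have "0 \<le> r h" "r h \<le> int q - 1"
      unfolding r_def using \<open>q > 0\<close> by (simp_all add: zle_diff1_eq)
    then have "0 \<le> (of_int (r h) :: real)" "(of_int (r h) :: real) \<le> real q - 1"
      by (simp, metis of_int_diff of_int_le_iff of_int_of_nat_eq of_int_1)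
    then show "0 \<le> (of_int (r h) + \<theta>) / real q" "(of_int (r h) + \<theta>) / real q < 1"
      using \<theta> \<open>q > 0\<close> by (simp_all add: field_simps)
  qed
  have "inj_on r {..<q}"
  proof (rule inj_onI)
    fix h k assume hk: "h \<in> {..<q}" "k \<in> {..<q}" "r h = r k"
    then have "int q dvd (N + a * int h) - (N + a * int k)"
      unfolding r_def by (simp only: mod_eq_dvd_iff)
    then have "int q dvd a * (int h - int k)" by (simp add: algebra_simps)
    then have "int q dvd int h - int k"
      using assms(1) by (simp add: coprime_commute coprime_dvd_mult_right_iff)
    then show "h = k"
      using hk zdvd_not_zless[of "int h - int k" "int q"] zdvd_not_zless[of "int k - int h" "int q"]
      by (metis lessThan_iff mod_eq_dvd_iff mod_less of_nat_eq_iff zmod_int)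
  qed
  moreover have "r ` {..<q} \<subseteq> int ` {..<q}"
  proof
    fix y assume "y \<in> r ` {..<q}"
    then have "0 \<le> y" "y < int q" unfolding r_def using \<open>q > 0\<close> by auto
    then show "y \<in> int ` {..<q}" by (metis image_eqI lessThan_iff nat_0_le of_nat_less_iff)
  qed
  moreover have "card (int ` {..<q}) = q" by (simp add: card_image)
  ultimately have "r ` {..<q} = int ` {..<q}"
    by (intro card_subset_eq) (auto simp: card_image)
  with \<open>inj_on r {..<q}\<close> have "(\<Sum>h<q. real_of_int (r h)) = (\<Sum>y\<in>int ` {..<q}. real_of_int y)"
    by (metis (no_types, lifting) sum.reindex_cong)
  also have "\<dots> = (\<Sum>j<q. real j)" by (simp add: sum.reindex)
  also have "\<dots> = real q * (real q - 1) / 2"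
    by (induction q) (auto simp: field_simps)
  finally have sum_r: "(\<Sum>h<q. real_of_int (r h)) = real q * (real q - 1) / 2" .
  have "(\<Sum>h<q. sawtooth (c + of_int a * real h / real q))
      = (\<Sum>h<q. of_int (r h) / real q + (\<theta> / real q - 1 / 2))"
    unfolding sawtooth_def by (simp only: frac add_divide_distrib add_diff_eq)
  also have "\<dots> = (\<Sum>h<q. real_of_int (r h)) / real q + (\<theta> - real q / 2)"
    unfolding sum.distrib sum_divide_distrib using \<open>q > 0\<close> by (simp add: field_simps)
  also have "\<dots> = \<theta> - 1 / 2"
    unfolding sum_r using \<open>q > 0\<close> by (simp add: field_simps)
  finally show ?thesis unfolding sawtooth_def \<theta>_def .
qed

text \<open>The jumps of the sawtooth do not spoil the cancellation: its only discontinuities are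
  downward, so a perturbation by at most \<open>\<delta>\<close> is compared, up to \<open>2 \<delta>\<close>, with the values on
  the lines moved down and up by \<open>\<delta>\<close>, and the exact evaluation applies to both lines. With
  \<open>\<delta> = E / q\<close> the loss over \<open>q\<close> terms is \<open>2 E\<close>, independent of \<open>q\<close>.\<close>
lemma abs_sum_sawtooth_near_rational_line:
  fixes a :: int and q :: nat and c E :: real and y :: "nat \<Rightarrow> real"
  assumes "coprime a (int q)" and "q > 0"
    and near: "\<And>h. h < q \<Longrightarrow> \<bar>y h - (c + of_int a * real h / real q)\<bar> \<le> E / real q"
  shows "\<bar>\<Sum>h<q. sawtooth (y h)\<bar> \<le> 2 * E + 1 / 2"
proof -
  define \<delta> where "\<delta> = E / real q"
  define z where "z h = of_int a * real h / real q" for h :: nat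
  \<comment> \<open>the floor is monotone, which gives both comparisons without locating any jump\<close>
  have upper: "sawtooth (y h) \<le> sawtooth (c - \<delta> + z h) + 2 * \<delta>"
    and lower: "sawtooth (c + \<delta> + z h) - 2 * \<delta> \<le> sawtooth (y h)" if "h < q" for h
  proof -
    from near[OF that] have y: "c - \<delta> + z h \<le> y h" "y h \<le> c + \<delta> + z h"
      unfolding \<delta>_def z_def by linarith+
    from floor_mono[OF y(1)] y show "sawtooth (y h) \<le> sawtooth (c - \<delta> + z h) + 2 * \<delta>"
      unfolding sawtooth_def frac_def by linarith
    from floor_mono[OF y(2)] y show "sawtooth (c + \<delta> + z h) - 2 * \<delta> \<le> sawtooth (y h)"
      unfolding sawtooth_def frac_def by linarith
  qed
  have q\<delta>: "real q * (2 * \<delta>) = 2 * E" unfolding \<delta>_def using \<open>q > 0\<close> by simp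
  have "(\<Sum>h<q. sawtooth (y h)) \<le> (\<Sum>h<q. sawtooth (c - \<delta> + z h) + 2 * \<delta>)"
    using upper by (intro sum_mono) auto
  also have "\<dots> = sawtooth (real q * (c - \<delta>)) + 2 * E"
    unfolding sum.distrib z_def sum_sawtooth_rational_line[OF assms(1,2)] using q\<delta> by simp
  finally have 1: "(\<Sum>h<q. sawtooth (y h)) \<le> sawtooth (real q * (c - \<delta>)) + 2 * E" .
  have "sawtooth (real q * (c + \<delta>)) - 2 * E = (\<Sum>h<q. sawtooth (c + \<delta> + z h) - 2 * \<delta>)"
    unfolding sum_subtractf z_def sum_sawtooth_rational_line[OF assms(1,2)] using q\<delta> by simp
  also have "\<dots> \<le> (\<Sum>h<q. sawtooth (y h))"
    using lower by (intro sum_mono) auto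
  finally show ?thesis
    using 1 abs_sawtooth_le[of "real q * (c - \<delta>)"] abs_sawtooth_le[of "real q * (c + \<delta>)"]
    by linarith
qed

section \<open>A second derivative test by rational approximation\<close>

text \<open>The range is cut greedily: the block that starts at \<open>n\<close> has length \<open>len n\<close>, and the next
  one starts where it ends. Only the last block can be incomplete, and it is estimated
  trivially by \<open>Q\<close>. The spacing of the starts is recorded because it is what later bounds
  their number.\<close>
lemma exists_block_starts:
  fixes g :: "nat \<Rightarrow> real" and len :: "nat \<Rightarrow> nat" and M N Q :: nat and E :: real
  assumes g: "\<And>k. \<bar>g k\<bar> \<le> 1"
    and len: "\<And>n. M \<le> n \<Longrightarrow> n < N \<Longrightarrow> 0 < len n \<and> len n \<le> Q"
    and block: "\<And>n. M \<le> n \<Longrightarrow> n + len n \<le> N \<Longrightarrow> \<bar>\<Sum>h<len n. g (n + h)\<bar> \<le> E"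
  obtains S where "S \<subseteq> {M..<N}"
    and "\<And>n m. n \<in> S \<Longrightarrow> m \<in> S \<Longrightarrow> n < m \<Longrightarrow> n + len n \<le> m"
    and "\<bar>\<Sum>k\<in>{M..<N}. g k\<bar> \<le> E * real (card S) + real Q"
proof -
  have "\<exists>S\<subseteq>{n0..<N}. (\<forall>n\<in>S. \<forall>m\<in>S. n < m \<longrightarrow> n + len n \<le> m)
      \<and> \<bar>\<Sum>k\<in>{n0..<N}. g k\<bar> \<le> E * real (card S) + real Q" if "M \<le> n0" for n0
    using that
  proof (induction "N - n0" arbitrary: n0 rule: less_induct)
    case less
    show ?case
    proof (cases "n0 + len n0 \<le> N \<and> n0 < N")
      case False
      have "\<bar>\<Sum>k\<in>{n0..<N}. g k\<bar> \<le> (\<Sum>k\<in>{n0..<N}. 1)"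
        by (rule order_trans[OF sum_abs]) (intro sum_mono g)
      also have "\<dots> \<le> real Q" using False len[of n0] less.prems by force
      finally show ?thesis by (intro exI[of _ "{}"]) simp
    next
      case True
      define n1 where "n1 = n0 + len n0"
      have n1: "n0 < n1" "n1 \<le> N" using True len[of n0] less.prems unfolding n1_def by auto
      obtain S where S: "S \<subseteq> {n1..<N}" "\<forall>n\<in>S. \<forall>m\<in>S. n < m \<longrightarrow> n + len n \<le> m"
        "\<bar>\<Sum>k\<in>{n1..<N}. g k\<bar> \<le> E * real (card S) + real Q"
      proof -
        have "N - n1 < N - n0" "M \<le> n1" using n1 less.prems by auto
        from less.hyps[OF this] show ?thesis using that by blast
      qed
      have "finite S" "n0 \<notin> S" using S(1) n1 finite_subset by auto
      have "(\<Sum>k\<in>{n0..<N}. g k) = (\<Sum>k\<in>{n0..<n1}. g k) + (\<Sum>k\<in>{n1..<N}. g k)"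
        using n1 by (simp add: sum.atLeastLessThan_concat)
      moreover have "(\<Sum>k\<in>{n0..<n1}. g k) = (\<Sum>h<len n0. g (n0 + h))"
        unfolding n1_def using sum.shift_bounds_nat_ivl[of g 0 n0 "len n0"]
        by (simp add: lessThan_atLeast0 add.commute)
      ultimately have "\<bar>\<Sum>k\<in>{n0..<N}. g k\<bar> \<le> E * real (card (insert n0 S)) + real Q"
        using block[of n0] less.prems True S(3) \<open>finite S\<close> \<open>n0 \<notin> S\<close> by (simp add: distrib_left)
      moreover have "\<forall>n\<in>insert n0 S. \<forall>m\<in>insert n0 S. n < m \<longrightarrow> n + len n \<le> m"
        using S(1,2) n1 unfolding n1_def by fastforce
      moreover have "insert n0 S \<subseteq> {n0..<N}" using S(1) n1 by auto
      ultimately show ?thesis by blast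
    qed
  qed
  from this[of M] show thesis using that by auto
qed

text \<open>Elements that are \<open>q\<close> apart lie in different cells of a subdivision into cells of length
  \<open>q\<close>.\<close>
lemma card_spaced_le:
  fixes S :: "nat set" and W :: real and q :: nat
  assumes "finite S" and "q > 0" and "W \<ge> 0"
    and gap: "\<And>n m. n \<in> S \<Longrightarrow> m \<in> S \<Longrightarrow> n < m \<Longrightarrow> n + q \<le> m"
    and diam: "\<And>n m. n \<in> S \<Longrightarrow> m \<in> S \<Longrightarrow> n < m \<Longrightarrow> real m - real n \<le> W"
  shows "real (card S) \<le> W / real q + 1"
proof (cases "S = {}")
  case True
  then show ?thesis using \<open>W \<ge> 0\<close> by simp
next
  case False
  define m0 where "m0 = Min S"
  have m0: "m0 \<in> S" "\<And>n. n \<in> S \<Longrightarrow> m0 \<le> n"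
    unfolding m0_def using False \<open>finite S\<close> by auto
  have "inj_on (\<lambda>n. (n - m0) div q) S"
  proof (rule linorder_inj_onI)
    fix n m assume nm: "n < m" "n \<in> S" "m \<in> S"
    then have "(n - m0) + q \<le> m - m0" using gap[of n m] m0(2) by force
    then have "((n - m0) + q) div q \<le> (m - m0) div q" by (rule div_le_mono)
    then show "(n - m0) div q \<noteq> (m - m0) div q" using \<open>q > 0\<close> by simp
  qed auto
  moreover have "(\<lambda>n. (n - m0) div q) ` S \<subseteq> {..nat \<lfloor>W / real q\<rfloor>}"
  proof (rule image_subsetI)
    fix n assume "n \<in> S"
    then have "real (n - m0) \<le> W" using diam[OF m0(1) \<open>n \<in> S\<close>] m0(2)[of n] \<open>W \<ge> 0\<close>
      by (cases "n = m0") auto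
    then have "real (n - m0) / real q \<le> W / real q" by (intro divide_right_mono) auto
    then have "real ((n - m0) div q) \<le> W / real q"
      using of_nat_div_le_of_nat[where ?'a = real, of "n - m0" q] by linarith
    then show "(n - m0) div q \<in> {..nat \<lfloor>W / real q\<rfloor>}" by (simp add: le_nat_floor)
  qed
  ultimately have "card S \<le> Suc (nat \<lfloor>W / real q\<rfloor>)"
    by (metis card_inj_on_le card_atMost finite_atMost)
  then have "real (card S) \<le> real (nat \<lfloor>W / real q\<rfloor>) + 1" by linarith
  then show ?thesis using of_nat_floor[of "W / real q"] \<open>W \<ge> 0\<close>
    by (meson add_right_mono divide_nonneg_nonneg of_nat_0_le_iff order_trans)
qed

lemma card_int_interval_le:
  fixes A B :: real
  assumes "A \<le> B"
  shows "finite {k :: int. A \<le> of_int k \<and> of_int k \<le> B}"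
    and "real (card {k :: int. A \<le> of_int k \<and> of_int k \<le> B}) \<le> B - A + 1"
proof -
  have "{k :: int. A \<le> of_int k \<and> of_int k \<le> B} = {\<lceil>A\<rceil>..\<lfloor>B\<rfloor>}"
    by (auto simp: ceiling_le_iff le_floor_iff)
  then show "finite {k :: int. A \<le> of_int k \<and> of_int k \<le> B}"
    and "real (card {k :: int. A \<le> of_int k \<and> of_int k \<le> B}) \<le> B - A + 1"
    using assms by (simp_all, linarith)
qed

text \<open>An elementary second derivative test: \<open>f\<close> is a function sampled at the integers, \<open>d\<close> is its
  derivative, and \<open>\<kappa>\<close> is the size of the second derivative.

  By Dirichlet's theorem \<open>d n\<close> is within \<open>1 / (l Q)\<close> of a reduced fraction \<open>a / l\<close> with
  \<open>l \<le> Q\<close>. On the \<open>l\<close> terms from \<open>n\<close> on, \<open>f\<close> follows the line of slope \<open>a / l\<close> up to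
  \<open>l / (l Q) + \<kappa> l\<^sup>2 \<le> 2 / l\<close>, because \<open>Q\<^sup>3 \<kappa> \<le> 1\<close>; so such a block contributes \<open>O(1)\<close>.

  It remains to count blocks. Long blocks are few since their starts are \<open>l\<close> apart. Short
  blocks are few since \<open>d\<close> moves at rate \<open>\<kappa>\<close> and therefore leaves the neighbourhood of
  \<open>a / l\<close> within \<open>O(1 / (l Q \<kappa>))\<close> steps. One fraction thus accounts for
  \<open>O(1 / (l\<^sup>2 Q \<kappa>) + 1)\<close> blocks, and there are at most \<open>l R + 3\<close> numerators for the
  denominator \<open>l\<close>, where \<open>R\<close> is the length of the range of \<open>d\<close>. Summing over \<open>l \<le> Q\<close> gives
  the bound.\<close>
lemma abs_sum_sawtooth_le_by_Dirichlet_blocks: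
  fixes f d :: "nat \<Rightarrow> real" and \<kappa> R D0 :: real and M N Q :: nat
  assumes "0 < \<kappa>" and "0 \<le> R" and "0 < Q" and Q\<kappa>: "real Q ^ 3 * \<kappa> \<le> 1"
    and taylor: "\<And>n h. M \<le> n \<Longrightarrow> n < N \<Longrightarrow> \<bar>f (n + h) - f n - real h * d n\<bar> \<le> \<kappa> * (real h)\<^sup>2"
    and range: "\<And>n. M \<le> n \<Longrightarrow> n < N \<Longrightarrow> D0 \<le> d n \<and> d n \<le> D0 + R"
    and steep: "\<And>n m. M \<le> n \<Longrightarrow> n < m \<Longrightarrow> m < N \<Longrightarrow> \<kappa> * (real m - real n) / 8 \<le> \<bar>d m - d n\<bar>"
  shows "\<bar>\<Sum>k\<in>{M..<N}. sawtooth (f k)\<bar>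
    \<le> 5 * ((real Q)\<^sup>2 * R + 3 * real Q + (16 * R + 48) * harm Q / (real Q * \<kappa>)) + real Q"
proof -
  have "\<exists>a l. coprime a (int l) \<and> 0 < l \<and> l \<le> Q \<and> \<bar>real l * d n - of_int a\<bar> < 1 / real Q" for n
  proof -
    from Dirichlet_approx_coprime[OF \<open>0 < Q\<close>, of "d n"] obtain a k where
      "coprime a k" "0 < k" "k \<le> int Q" "\<bar>of_int k * d n - of_int a\<bar> < 1 / real Q" .
    then show ?thesis by (intro exI[of _ a] exI[of _ "nat k"]) auto
  qed
  then obtain num len where label: "\<And>n. coprime (num n) (int (len n))" "\<And>n. 0 < len n"
      "\<And>n. len n \<le> Q" "\<And>n. \<bar>real (len n) * d n - of_int (num n)\<bar> < 1 / real Q"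
    by metis
  have slope: "\<bar>d n - of_int (num n) / real (len n)\<bar> < 1 / (real (len n) * real Q)" for n
  proof -
    have "\<bar>d n - of_int (num n) / real (len n)\<bar> = \<bar>real (len n) * d n - of_int (num n)\<bar> / real (len n)"
      using label(2)[of n] by (simp add: abs_div_pos diff_divide_distrib)
    also have "\<dots> < (1 / real Q) / real (len n)"
      using label(2,4)[of n] by (intro divide_strict_right_mono) auto
    finally show ?thesis by (simp add: mult.commute)
  qed
  have block: "\<bar>\<Sum>h<len n. sawtooth (f (n + h))\<bar> \<le> 5" if "M \<le> n" "n + len n \<le> N" for n
  proof -
    define l where "l = len n"
    have l: "0 < l" "l \<le> Q" unfolding l_def using label by auto
    have "\<bar>f (n + h) - (f n + of_int (num n) * real h / real l)\<bar> \<le> 2 / real l" if "h < l" for h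
    proof -
      have "\<bar>real h * (d n - of_int (num n) / real l)\<bar> \<le> real l * (1 / (real l * real Q))"
        unfolding abs_mult using slope[of n] that l by (intro mult_mono) (auto simp: l_def)
      also have "\<dots> \<le> 1 / real l" using l by (simp add: field_simps)
      finally have 1: "\<bar>real h * (d n - of_int (num n) / real l)\<bar> \<le> 1 / real l" .
      have "\<kappa> * (real h)\<^sup>2 \<le> \<kappa> * (real l)\<^sup>2"
        using that \<open>0 < \<kappa>\<close> by (intro mult_left_mono power_mono) auto
      also have "\<dots> = \<kappa> * real l ^ 3 / real l" using l by (simp add: field_simps power2_eq_square power3_eq_cube)
      also have "\<dots> \<le> \<kappa> * real Q ^ 3 / real l"
        using l \<open>0 < \<kappa>\<close> by (intro divide_right_mono mult_left_mono power_mono) auto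
      also have "\<dots> \<le> 1 / real l" using Q\<kappa> l by (intro divide_right_mono) (auto simp: mult.commute)
      finally have 2: "\<bar>f (n + h) - f n - real h * d n\<bar> \<le> 1 / real l"
        using taylor[of n h] \<open>M \<le> n\<close> \<open>n + len n \<le> N\<close> l l_def by linarith
      have "f (n + h) - (f n + of_int (num n) * real h / real l)
          = (f (n + h) - f n - real h * d n) + real h * (d n - of_int (num n) / real l)"
        by (simp add: algebra_simps)
      then show ?thesis using 1 2 by linarith
    qed
    from abs_sum_sawtooth_near_rational_line[OF label(1)[of n, folded l_def] l(1) this]
    show ?thesis unfolding l_def by simp
  qed
  have unit: "\<bar>sawtooth (f k)\<bar> \<le> 1" for k using abs_sawtooth_le[of "f k"] by linarith
  obtain S where S: "S \<subseteq> {M..<N}"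
    and gap: "\<And>n m. n \<in> S \<Longrightarrow> m \<in> S \<Longrightarrow> n < m \<Longrightarrow> n + len n \<le> m"
    and sum: "\<bar>\<Sum>k\<in>{M..<N}. sawtooth (f k)\<bar> \<le> 5 * real (card S) + real Q"
    using exists_block_starts[of "\<lambda>k. sawtooth (f k)" M N len Q 5] unit label block by blast
  have "finite S" using S finite_subset by blast
  define fibre where "fibre l a = {n \<in> S. len n = l \<and> num n = a}" for l a
  define A where "A l = {a :: int. real l * D0 - 1 \<le> of_int a \<and> of_int a \<le> real l * D0 + real l * R + 1}" for l
  have fin_A: "finite (A l)" and card_A: "real (card (A l)) \<le> real l * R + 3" for l
    using card_int_interval_le[of "real l * D0 - 1" "real l * D0 + real l * R + 1"] \<open>0 \<le> R\<close>
    unfolding A_def by auto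
  have card_fibre: "real (card (fibre l a)) \<le> 16 / (real l * real Q * \<kappa>) / real l + 1" if "0 < l" for l a
  proof (rule card_spaced_le)
    show "finite (fibre l a)" unfolding fibre_def using \<open>finite S\<close> by simp
    fix n m assume nm: "n \<in> fibre l a" "m \<in> fibre l a" "n < m"
    then show "n + l \<le> m" using gap unfolding fibre_def by auto
    have "\<bar>d m - d n\<bar> \<le> 2 * (1 / (real l * real Q))"
      using slope[of n] slope[of m] nm unfolding fibre_def by simp
    moreover have "\<kappa> * (real m - real n) / 8 \<le> \<bar>d m - d n\<bar>"
      using nm S by (intro steep) (auto simp: fibre_def)
    ultimately have "\<kappa> * (real m - real n) / 8 \<le> 2 * (1 / (real l * real Q))" by linarith
    then show "real m - real n \<le> 16 / (real l * real Q * \<kappa>)"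
      using \<open>0 < l\<close> \<open>0 < Q\<close> \<open>0 < \<kappa>\<close> by (simp add: field_simps)
  qed (use that \<open>0 < \<kappa>\<close> in auto)
  have "S \<subseteq> (\<Union>l\<in>{1..Q}. \<Union>a\<in>A l. fibre l a)"
  proof
    fix n assume "n \<in> S"
    then have D: "D0 \<le> d n" "d n \<le> D0 + R" using range[of n] S by auto
    have "real (len n) * D0 \<le> real (len n) * d n" "real (len n) * d n \<le> real (len n) * (D0 + R)"
      using D by (simp_all add: mult_left_mono)
    moreover have "1 / real Q \<le> 1" using \<open>0 < Q\<close> by simp
    ultimately have "num n \<in> A (len n)" unfolding A_def using label(4)[of n]
      by (auto simp: distrib_left abs_less_iff)
    then show "n \<in> (\<Union>l\<in>{1..Q}. \<Union>a\<in>A l. fibre l a)"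
      using label(2,3)[of n] \<open>n \<in> S\<close> by (auto simp: fibre_def Suc_le_eq)
  qed
  then have "card S \<le> card (\<Union>l\<in>{1..Q}. \<Union>a\<in>A l. fibre l a)"
    using fin_A \<open>finite S\<close> by (intro card_mono) (auto simp: fibre_def)
  also have "\<dots> \<le> (\<Sum>l\<in>{1..Q}. card (\<Union>a\<in>A l. fibre l a))" by (intro card_UN_le) simp
  also have "\<dots> \<le> (\<Sum>l\<in>{1..Q}. \<Sum>a\<in>A l. card (fibre l a))"
    by (intro sum_mono card_UN_le fin_A)
  finally have "real (card S) \<le> real (\<Sum>l\<in>{1..Q}. \<Sum>a\<in>A l. card (fibre l a))" by linarith
  also have "\<dots> = (\<Sum>l\<in>{1..Q}. \<Sum>a\<in>A l. real (card (fibre l a)))" by simp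
  also have "\<dots> \<le> (\<Sum>l\<in>{1..Q}. real Q * R + 3 + (16 * R + 48) / (real Q * \<kappa>) * inverse (real l))"
  proof (rule sum_mono)
    fix l assume l: "l \<in> {1..Q}"
    have "(\<Sum>a\<in>A l. real (card (fibre l a))) \<le> real (card (A l)) * (16 / (real l * real Q * \<kappa>) / real l + 1)"
      using card_fibre[of l] l by (intro sum_bounded_above) auto
    also have "\<dots> \<le> (real l * R + 3) * (16 / (real l * real Q * \<kappa>) / real l + 1)"
      using card_A \<open>0 < \<kappa>\<close> by (intro mult_right_mono) auto
    also have "\<dots> = real l * R + 3 + (16 * R + 48 / real l) / (real Q * \<kappa>) * inverse (real l)"
      using l \<open>0 < Q\<close> \<open>0 < \<kappa>\<close> by (simp add: field_simps)
    also have "\<dots> \<le> real Q * R + 3 + (16 * R + 48) / (real Q * \<kappa>) * inverse (real l)"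
      using l \<open>0 < \<kappa>\<close> \<open>0 \<le> R\<close>
      by (intro add_mono mult_right_mono divide_right_mono) (auto simp: field_simps)
    finally show "(\<Sum>a\<in>A l. real (card (fibre l a)))
        \<le> real Q * R + 3 + (16 * R + 48) / (real Q * \<kappa>) * inverse (real l)" .
  qed
  also have "\<dots> = (real Q)\<^sup>2 * R + 3 * real Q + (16 * R + 48) * harm Q / (real Q * \<kappa>)"
    unfolding sum.distrib sum_distrib_left[symmetric] harm_def
    by (simp add: power2_eq_square algebra_simps)
  finally have "real (card S)
    \<le> (real Q)\<^sup>2 * R + 3 * real Q + (16 * R + 48) * harm Q / (real Q * \<kappa>)" .
  then show ?thesis using sum
    by (meson add_right_mono mult_left_mono order_trans zero_le_numeral)
qed

section \<open>Sawtooth sums over the hyperbola\<close>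

lemma harm_le_ln_plus_1: "0 < n \<Longrightarrow> harm n \<le> 1 + ln (real n)"
  using decseqD[OF decseq_harm_diff_ln, of 0 "n - 1"] by (simp add: harm_expand)

text \<open>On a dyadic interval the second derivative of \<open>X / u\<close> has constant order \<open>\<kappa> = X / M\<^sup>3\<close> and
  its first derivative ranges over an interval of length \<open>R = X / M\<^sup>2\<close>. The largest
  admissible denominator is then about \<open>\<kappa>\<close> to the power \<open>-1/3\<close>, which is \<open>M / Y\<close> for
  \<open>X = Y\<^sup>3\<close>; with this choice every term of the second derivative test is \<open>O(Y)\<close> up to a
  logarithm, as long as \<open>M\<close> is at most of order \<open>\<surd>X\<close>. Working with \<open>Y\<close> instead of \<open>X\<close> keeps
  all exponents integral. For \<open>M < Y\<close> the admissible \<open>Q\<close> would be \<open>0\<close>.\<close>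
lemma abs_sum_sawtooth_hyperbola_dyadic:
  fixes X Y C \<beta> \<gamma> :: real and M N :: nat
  assumes "1 \<le> Y" and "1 \<le> C" and "0 < \<beta>" and "\<beta> \<le> 1" and XY: "X = Y ^ 3"
    and MY: "Y \<le> real M" and MC: "(real M)\<^sup>2 \<le> C * Y ^ 3" and "M \<le> N" and "N \<le> 2 * M"
  shows "\<bar>\<Sum>k\<in>{M..<N}. sawtooth (X / (real k + \<beta>) + \<gamma>)\<bar> \<le> 700 * C * Y * (1 + ln (real N))"
proof -
  define u where "u k = real k + \<beta>" for k :: nat
  define Q where "Q = nat \<lfloor>real M / Y\<rfloor>"
  define \<kappa> where "\<kappa> = X / real M ^ 3"
  define R where "R = X / (real M)\<^sup>2"
  have "0 < Y" "0 < X" using \<open>1 \<le> Y\<close> XY by auto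
  have M: "0 < real M" "1 \<le> real M" using MY \<open>1 \<le> Y\<close> by linarith+
  have "1 \<le> real M / Y" using MY \<open>0 < Y\<close> by simp
  then have Q: "0 < Q" "real Q \<le> real M / Y" "real M / Y \<le> 2 * real Q"
  proof -
    have z: "1 \<le> \<lfloor>real M / Y\<rfloor>" using \<open>1 \<le> real M / Y\<close> by (simp add: le_floor_iff)
    then have "real Q = of_int \<lfloor>real M / Y\<rfloor>" unfolding Q_def by simp
    with z show "0 < Q" "real Q \<le> real M / Y" "real M / Y \<le> 2 * real Q"
      using real_of_int_floor_add_one_gt[of "real M / Y"] of_int_floor_le[of "real M / Y"]
      unfolding Q_def by linarith+
  qed
  have QM: "Q \<le> M"
  proof -
    have "real M / Y \<le> real M / 1" using \<open>1 \<le> Y\<close> by (intro divide_left_mono) auto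
    then show ?thesis using Q(2) by simp
  qed
  have \<kappa>: "0 < \<kappa>" and "0 \<le> R" unfolding \<kappa>_def R_def using \<open>0 < X\<close> M by auto
  have upos: "0 < u k" for k unfolding u_def using \<open>0 < \<beta>\<close> by simp
  have uM: "real M \<le> u k" if "M \<le> k" for k unfolding u_def using \<open>0 < \<beta>\<close> that by simp
  have "real Q ^ 3 * \<kappa> \<le> (real M / Y) ^ 3 * \<kappa>"
    using Q(2) \<kappa> by (intro mult_right_mono power_mono) auto
  also have "\<dots> = 1" unfolding \<kappa>_def XY using M \<open>0 < Y\<close> by (simp add: field_simps)
  finally have Q\<kappa>: "real Q ^ 3 * \<kappa> \<le> 1" .
  have main: "\<bar>\<Sum>k\<in>{M..<N}. sawtooth (X / u k + \<gamma>)\<bar>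
      \<le> 5 * ((real Q)\<^sup>2 * R + 3 * real Q + (16 * R + 48) * harm Q / (real Q * \<kappa>)) + real Q"
  proof (rule abs_sum_sawtooth_le_by_Dirichlet_blocks[where d = "\<lambda>n. - X / (u n)\<^sup>2" and ?D0.0 = "- R"])
    fix n h assume n: "M \<le> n" "n < N"
    have uh: "u (n + h) = u n + real h" unfolding u_def by simp
    have "X / u (n + h) + \<gamma> - (X / u n + \<gamma>) - real h * (- X / (u n)\<^sup>2)
        = X * (real h)\<^sup>2 / ((u n)\<^sup>2 * u (n + h))"
    proof -
      have "u n \<noteq> 0" "u n + real h \<noteq> 0" using upos[of n] upos[of "n + h"] uh by auto
      then show ?thesis
        unfolding uh by (simp add: divide_simps) (simp add: algebra_simps power2_eq_square)
    qed
    moreover have "X * (real h)\<^sup>2 / ((u n)\<^sup>2 * u (n + h)) \<le> X * (real h)\<^sup>2 / ((real M)\<^sup>2 * real M)"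
      using uM[of n] uM[of "n + h"] n M \<open>0 < X\<close> upos
      by (intro divide_left_mono mult_mono power_mono mult_pos_pos) auto
    moreover have "0 \<le> X * (real h)\<^sup>2 / ((u n)\<^sup>2 * u (n + h))"
      using \<open>0 < X\<close> upos[of "n + h"] by simp
    ultimately show "\<bar>X / u (n + h) + \<gamma> - (X / u n + \<gamma>) - real h * (- X / (u n)\<^sup>2)\<bar> \<le> \<kappa> * (real h)\<^sup>2"
      unfolding \<kappa>_def by (simp add: power2_eq_square power3_eq_cube)
  next
    fix n assume "M \<le> n" "n < N"
    have "X / (u n)\<^sup>2 \<le> R" unfolding R_def
      using uM[OF \<open>M \<le> n\<close>] M \<open>0 < X\<close> by (intro divide_left_mono power_mono) auto
    moreover have "0 \<le> X / (u n)\<^sup>2" using \<open>0 < X\<close> by simp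
    ultimately show "- R \<le> - X / (u n)\<^sup>2 \<and> - X / (u n)\<^sup>2 \<le> - R + R" by simp
  next
    fix n m assume nm: "M \<le> n" "n < m" "m < N"
    have v: "0 < u n" "0 < u m" "real M \<le> u n" "real M \<le> u m" "u n < u m"
      using upos uM nm unfolding u_def by auto
    have "m + 1 \<le> 2 * M" using nm \<open>N \<le> 2 * M\<close> by simp
    then have w: "u n \<le> 2 * real M" "u m \<le> 2 * real M"
      using nm \<open>\<beta> \<le> 1\<close> unfolding u_def by linarith+
    \<comment> \<open>\<open>1/u\<^sup>2 - 1/v\<^sup>2 = (v - u)(u + v) / (u\<^sup>2 v\<^sup>2)\<close>, with both points between \<open>M\<close> and \<open>2 M\<close>\<close>
    have "\<kappa> * (real m - real n) / 8 = (X * (u m - u n)) * (2 * real M / ((2 * real M)\<^sup>2 * (2 * real M)\<^sup>2))"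
      unfolding \<kappa>_def u_def using M by (simp add: field_simps power2_eq_square power3_eq_cube)
    also have "\<dots> \<le> (X * (u m - u n)) * ((u n + u m) / ((u n)\<^sup>2 * (u m)\<^sup>2))"
      using v w M \<open>0 < X\<close>
      by (intro mult_left_mono frac_le mult_mono power_mono mult_pos_pos) auto
    also have "\<dots> = - X / (u m)\<^sup>2 - (- X / (u n)\<^sup>2)"
      using v by (simp add: field_simps power2_eq_square)
    finally show "\<kappa> * (real m - real n) / 8 \<le> \<bar>- X / (u m)\<^sup>2 - (- X / (u n)\<^sup>2)\<bar>" by linarith
  qed (use \<kappa> \<open>0 \<le> R\<close> Q(1) Q\<kappa> in auto)
  define H where "H = 1 + ln (real N)"
  have "1 \<le> H" unfolding H_def using M \<open>M \<le> N\<close> by simp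
  have harm: "harm Q \<le> H"
  proof -
    have "ln (real Q) \<le> ln (real N)" using Q(1) QM \<open>M \<le> N\<close> by simp
    then show ?thesis using harm_le_ln_plus_1[OF Q(1)] unfolding H_def by linarith
  qed
  have MCY: "real M \<le> C * Y\<^sup>2"
  proof (rule power2_le_imp_le)
    have "C * Y ^ 3 \<le> C\<^sup>2 * Y ^ 4"
      using \<open>1 \<le> C\<close> \<open>1 \<le> Y\<close> by (intro mult_mono power_increasing) (auto simp: power2_eq_square)
    then show "(real M)\<^sup>2 \<le> (C * Y\<^sup>2)\<^sup>2" using MC by (simp add: power_mult_distrib)
  qed (use \<open>1 \<le> C\<close> in auto)
  have 1: "(real Q)\<^sup>2 * R \<le> Y"
  proof -
    have "(real Q)\<^sup>2 * R \<le> (real M / Y)\<^sup>2 * R"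
      using Q(2) \<open>0 \<le> R\<close> by (intro mult_right_mono power_mono) auto
    also have "\<dots> = Y" unfolding R_def XY using M \<open>0 < Y\<close>
      by (simp add: field_simps power2_eq_square power3_eq_cube)
    finally show ?thesis .
  qed
  have 2: "real Q \<le> C * Y"
  proof -
    have "real M / Y \<le> C * Y" using MCY \<open>0 < Y\<close> by (simp add: field_simps power2_eq_square)
    then show ?thesis using Q(2) by linarith
  qed
  have inv: "1 / (real Q * \<kappa>) \<le> 2 * (real M)\<^sup>2 / Y\<^sup>2"
  proof -
    have "1 / (real Q * \<kappa>) \<le> 1 / (real M / Y / 2 * \<kappa>)"
      using Q \<kappa> M \<open>0 < Y\<close> by (intro divide_left_mono mult_right_mono mult_pos_pos) auto
    also have "\<dots> = 2 * (real M)\<^sup>2 / Y\<^sup>2" unfolding \<kappa>_def XY using M \<open>0 < Y\<close>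
      by (simp add: field_simps power2_eq_square power3_eq_cube)
    finally show ?thesis .
  qed
  have 3: "(16 * R + 48) * harm Q / (real Q * \<kappa>) \<le> (32 * Y + 96 * C * Y) * H"
  proof -
    have "(16 * R + 48) * (1 / (real Q * \<kappa>)) \<le> (16 * R + 48) * (2 * (real M)\<^sup>2 / Y\<^sup>2)"
      using inv \<open>0 \<le> R\<close> by (intro mult_left_mono) auto
    also have "\<dots> = 32 * Y + 96 * ((real M)\<^sup>2 / Y\<^sup>2)" unfolding R_def XY using M \<open>0 < Y\<close>
      by (simp add: field_simps power2_eq_square power3_eq_cube)
    also have "\<dots> \<le> 32 * Y + 96 * (C * Y)"
      using MC \<open>0 < Y\<close> by (simp add: field_simps power2_eq_square power3_eq_cube)
    finally have "(16 * R + 48) * (1 / (real Q * \<kappa>)) * harm Q \<le> (32 * Y + 96 * (C * Y)) * H"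
      using harm \<open>1 \<le> H\<close> \<open>0 < Y\<close> \<open>1 \<le> C\<close> by (intro mult_mono) (auto simp: harm_nonneg)
    then show ?thesis by (simp add: mult.assoc)
  qed
  have CY: "Y \<le> C * Y" "C * Y \<le> C * Y * H"
    using \<open>1 \<le> C\<close> \<open>0 < Y\<close> \<open>1 \<le> H\<close> by simp_all
  have "32 * Y * H \<le> 32 * (C * Y * H)" using mult_right_mono[OF CY(1), of H] \<open>1 \<le> H\<close> by simp
  then have "(32 * Y + 96 * C * Y) * H \<le> 128 * (C * Y * H)" by (simp add: algebra_simps)
  with 3 have 4: "(16 * R + 48) * harm Q / (real Q * \<kappa>) \<le> 128 * (C * Y * H)" by linarith
  have "5 * (z1 + 3 * z2 + z3) + z2 \<le> 700 * z"
    if "z1 \<le> Y" "z2 \<le> c" "z3 \<le> 128 * z" "Y \<le> c" "c \<le> z" for z1 z2 z3 c z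
    using that \<open>0 < Y\<close> by argo
  from this[OF 1 2 4 CY]
  have "5 * ((real Q)\<^sup>2 * R + 3 * real Q + (16 * R + 48) * harm Q / (real Q * \<kappa>)) + real Q
      \<le> 700 * (C * Y * H)" .
  with main show ?thesis unfolding u_def H_def by (simp add: mult.assoc)
qed

text \<open>Halving the range repeatedly costs one dyadic interval each time, hence a further
  logarithm; the terms with \<open>k < 2 Y\<close> are estimated trivially.\<close>
lemma abs_sum_sawtooth_hyperbola:
  fixes X Y C \<beta> \<gamma> :: real and N :: nat
  assumes "1 \<le> Y" and "1 \<le> C" and "0 < \<beta>" and "\<beta> \<le> 1" and XY: "X = Y ^ 3"
    and NC: "(real N)\<^sup>2 \<le> C * Y ^ 3"
  shows "\<bar>\<Sum>k<N. sawtooth (X / (real k + \<beta>) + \<gamma>)\<bar> \<le> 2102 * C * Y * (1 + ln (real N))\<^sup>2"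
proof (cases "N = 0")
  case True
  then show ?thesis using assms by simp
next
  case False
  define B where "B = 700 * C * Y * (1 + ln (real N))"
  define g where "g k = sawtooth (X / (real k + \<beta>) + \<gamma>)" for k :: nat
  have "0 \<le> ln (real N)" using False by simp
  then have "0 \<le> B" unfolding B_def using assms by simp
  have unit: "\<bar>g k\<bar> \<le> 1" for k
    unfolding g_def using abs_sawtooth_le[of "X / (real k + \<beta>) + \<gamma>"] by linarith
  have "\<bar>\<Sum>k<n. g k\<bar> \<le> 2 * Y + 3 * B * ln (real n)" if "0 < n" "n \<le> N" for n
    using that
  proof (induction n rule: less_induct)
    case (less n)
    show ?case
    proof (cases "real n \<le> 2 * Y")
      case True
      have "\<bar>\<Sum>k<n. g k\<bar> \<le> (\<Sum>k<n. 1)"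
        by (rule order_trans[OF sum_abs]) (intro sum_mono unit)
      also have "\<dots> \<le> 2 * Y" using True by simp
      finally show ?thesis using \<open>0 \<le> B\<close> less.prems by (simp add: add_increasing2)
    next
      case False
      \<comment> \<open>rounding up keeps \<open>n \<le> 2 M\<close>; as \<open>n \<ge> 3\<close>, still \<open>M \<le> 2 n / 3\<close>, so each halving
        lowers \<open>ln n\<close> by at least \<open>ln (3/2) \<ge> 1/3\<close>\<close>
      define M where "M = (n + 1) div 2"
      have n3: "3 \<le> n" using False \<open>1 \<le> Y\<close> by linarith
      have M: "0 < M" "M < n" "n \<le> 2 * M" "3 * M \<le> 2 * n" unfolding M_def using n3 by linarith+
      have "real M \<le> real N" using M less.prems by simp
      then have "(real M)\<^sup>2 \<le> C * Y ^ 3" by (intro order_trans[OF power_mono NC]) auto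
      moreover have "Y \<le> real M" using False M(3) by linarith
      ultimately have "\<bar>\<Sum>k\<in>{M..<n}. g k\<bar> \<le> 700 * C * Y * (1 + ln (real n))"
        unfolding g_def using assms M by (intro abs_sum_sawtooth_hyperbola_dyadic) auto
      also have "\<dots> \<le> B" unfolding B_def using assms less.prems by (intro mult_left_mono) auto
      finally have tail: "\<bar>\<Sum>k\<in>{M..<n}. g k\<bar> \<le> B" .
      have "1 / 3 \<le> ln (3 / 2 :: real)" using ln_ge_iff[of "3/2" "1/3"] exp_bound[of "1/3 :: real"] by (simp add: power2_eq_square)
      then have "1 / 3 \<le> ln (3 / 2 * real M) - ln (real M)" using M by (subst ln_mult) auto
      moreover have "ln (3 / 2 * real M) \<le> ln (real n)" using M by (subst ln_le_cancel_iff) auto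
      ultimately have "3 * B * ln (real M) \<le> 3 * B * (ln (real n) - 1 / 3)"
        using \<open>0 \<le> B\<close> by (intro mult_left_mono) auto
      moreover have "\<bar>\<Sum>k<M. g k\<bar> \<le> 2 * Y + 3 * B * ln (real M)"
        using less.IH[of M] M less.prems by simp
      moreover have "(\<Sum>k<n. g k) = (\<Sum>k<M. g k) + (\<Sum>k\<in>{M..<n}. g k)"
        using M by (simp add: lessThan_atLeast0 sum.atLeastLessThan_concat)
      ultimately show ?thesis using tail by (simp add: right_diff_distrib)
    qed
  qed
  from this[of N] False have "\<bar>\<Sum>k<N. g k\<bar> \<le> 2 * Y + 3 * B * ln (real N)" by simp
  also have "\<dots> \<le> 2102 * C * Y * (1 + ln (real N))\<^sup>2"
  proof -
    define L where "L = 1 + ln (real N)"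
    have L: "1 \<le> L" "ln (real N) \<le> L" unfolding L_def using \<open>0 \<le> ln (real N)\<close> by auto
    have "Y * 1 \<le> (C * Y) * L\<^sup>2"
      using L assms by (intro mult_mono) auto
    moreover have "3 * B * ln (real N) \<le> 3 * B * L" using \<open>0 \<le> B\<close> L by (intro mult_left_mono) auto
    moreover have "3 * B * L = 2100 * (C * Y * L\<^sup>2)"
      unfolding B_def L_def by (simp add: power2_eq_square)
    ultimately show ?thesis unfolding L_def[symmetric] by (simp add: mult.assoc)
  qed
  finally show ?thesis unfolding g_def .
qed

section \<open>Periodic weights of mean value zero\<close>

lemma sum_split_residues:
  fixes F h :: "nat \<Rightarrow> real" and p N :: nat
  assumes "0 < p" and per: "\<And>n. F (n + p) = F n"
  shows "(\<Sum>n\<in>{1..N}. F n * h n) = (\<Sum>j\<in>{1..p}. F j * (\<Sum>k<(N + p - j) div p. h (p * k + j)))"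
proof -
  have per': "F (p * k + j) = F j" for k j
  proof (induction k)
    case (Suc k)
    have "F (p * Suc k + j) = F ((p * k + j) + p)" by (simp add: algebra_simps)
    also have "\<dots> = F j" unfolding per by (rule Suc)
    finally show ?case .
  qed simp
  have less_iff: "k < (N + p - j) div p \<longleftrightarrow> p * k + j \<le> N" if "j \<le> p" for k j
  proof -
    have "k < (N + p - j) div p \<longleftrightarrow> Suc k * p \<le> N + p - j"
      using less_eq_div_iff_mult_less_eq[OF \<open>0 < p\<close>, of "Suc k" "N + p - j"] by (simp add: Suc_le_eq)
    also have "\<dots> \<longleftrightarrow> p * k + j \<le> N" using that by (simp add: mult.commute) linarith
    finally show ?thesis .
  qed
  have "(\<Sum>j\<in>{1..p}. F j * (\<Sum>k<(N + p - j) div p. h (p * k + j)))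
      = (\<Sum>(j, k)\<in>(SIGMA j:{1..p}. {..<(N + p - j) div p}). F j * h (p * k + j))"
    by (simp add: sum_distrib_left sum.Sigma)
  also have "\<dots> = (\<Sum>n\<in>{1..N}. F n * h n)"
  proof (rule sum.reindex_bij_witness[where j = "\<lambda>(j, k). p * k + j"
        and i = "\<lambda>n. ((n - 1) mod p + 1, (n - 1) div p)"])
    fix jk assume "jk \<in> (SIGMA j:{1..p}. {..<(N + p - j) div p})"
    then obtain j k where jk: "jk = (j, k)" "1 \<le> j" "j \<le> p" "p * k + j \<le> N"
      using less_iff by (cases jk) auto
    have e: "p * k + j - 1 = (j - 1) + k * p" using jk(2) by (simp add: mult.commute)
    have "j - 1 < p" using jk(2,3) by simp
    then have inv: "(p * k + j - 1) mod p = j - 1" "(p * k + j - 1) div p = k"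
      unfolding e using \<open>0 < p\<close> by simp_all
    show "(((case jk of (j, k) \<Rightarrow> p * k + j) - 1) mod p + 1, ((case jk of (j, k) \<Rightarrow> p * k + j) - 1) div p) = jk"
      using inv jk by simp
    show "(case jk of (j, k) \<Rightarrow> p * k + j) \<in> {1..N}" using jk by auto
    show "F (case jk of (j, k) \<Rightarrow> p * k + j) * h (case jk of (j, k) \<Rightarrow> p * k + j)
        = (case jk of (j, k) \<Rightarrow> F j * h (p * k + j))" using jk per' by simp
  next
    fix n assume n: "n \<in> {1..N}"
    have e: "p * ((n - 1) div p) + ((n - 1) mod p + 1) = n" using n by simp
    then show "(case ((n - 1) mod p + 1, (n - 1) div p) of (j, k) \<Rightarrow> p * k + j) = n" by simp
    have "(n - 1) mod p + 1 \<le> p" using \<open>0 < p\<close> by (simp add: Suc_le_eq)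
    then show "((n - 1) mod p + 1, (n - 1) div p) \<in> (SIGMA j:{1..p}. {..<(N + p - j) div p})"
      using less_iff[of "(n - 1) mod p + 1" "(n - 1) div p"] e n by simp
  qed
  finally show ?thesis by simp
qed

text \<open>The number of terms is \<open>u + 1/2 - sawtooth u\<close> with \<open>u = (y - j) / p\<close>. Inserted into the
  closed form of the sum, it makes the contributions linear in \<open>y\<close> cancel, so that the
  dependence on \<open>j\<close> sits only in the argument of the sawtooth.\<close>
lemma abs_sum_arith_progression_sawtooth:
  fixes y :: real and p j N :: nat
  assumes "1 \<le> j" and "j \<le> p" and "real N \<le> y" and "y < real N + 1"
  shows "\<bar>(\<Sum>k<(N + p - j) div p. real (p * k + j))
    - (y\<^sup>2 / (2 * real p) - y * sawtooth ((y - real j) / real p))\<bar> \<le> real p"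
proof -
  define T where "T = (N + p - j) div p"
  define u where "u = (y - real j) / real p"
  define w where "w = real j / real p"
  define \<psi> where "\<psi> = sawtooth u"
  have "0 < p" using assms by simp
  have "p * T \<le> N + p - j" unfolding T_def by simp
  then have "p * T + j \<le> N + p" using assms by linarith
  then have "real p * real T + real j \<le> real N + real p"
    by (metis of_nat_add of_nat_le_iff of_nat_mult)
  then have lo: "real T - 1 \<le> u" unfolding u_def using \<open>0 < p\<close> assms by (simp add: field_simps)
  have "N + p - j < p * T + p" unfolding T_def using \<open>0 < p\<close>
    by (metis add.commute dividend_less_times_div)
  then have "N + 1 \<le> p * T + j" using assms by linarith
  then have "real N + 1 \<le> real p * real T + real j"
    by (metis of_nat_1 of_nat_add of_nat_le_iff of_nat_mult)
  then have hi: "u < real T" unfolding u_def using \<open>0 < p\<close> assms by (simp add: field_simps)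
  have "\<lfloor>u\<rfloor> = int T - 1" using lo hi by (intro floor_unique) auto
  then have t: "real T = u + 1 / 2 - \<psi>" unfolding \<psi>_def sawtooth_def frac_def by simp
  have y: "y = real p * (u + w)" and j: "real j = real p * w"
    unfolding u_def w_def using \<open>0 < p\<close> by (simp_all add: field_simps)
  have w: "0 \<le> w" "w \<le> 1" unfolding w_def using assms by auto
  have closed: "(\<Sum>k<T. real (p * k + j)) = real p * (real T * (real T - 1) / 2) + real j * real T" for T
    by (induction T) (auto simp: field_simps)
  have "(\<Sum>k<T. real (p * k + j)) - (y\<^sup>2 / (2 * real p) - y * \<psi>)
      = real p * (real T * (real T - 1) / 2 + w * real T - (u + w)\<^sup>2 / 2 + (u + w) * \<psi>)"
    unfolding closed y j using \<open>0 < p\<close> by (simp add: field_simps power2_eq_square)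
  also have "\<dots> = real p * ((\<psi>\<^sup>2 - 1 / 4) / 2 + w * (1 - w) / 2)"
    unfolding t by (simp add: field_simps power2_eq_square)
  finally have eq: "(\<Sum>k<T. real (p * k + j)) - (y\<^sup>2 / (2 * real p) - y * \<psi>)
      = real p * ((\<psi>\<^sup>2 - 1 / 4) / 2 + w * (1 - w) / 2)" .
  define v where "v = w * (1 - w)"
  define z where "z = \<psi>\<^sup>2"
  have "\<psi>\<^sup>2 \<le> (1 / 2)\<^sup>2"
    using abs_sawtooth_le[of u] unfolding \<psi>_def by (intro power2_le_iff_abs_le[THEN iffD2]) auto
  then have "0 \<le> z" "z \<le> 1 / 4" unfolding z_def by (simp_all add: power2_eq_square)
  moreover have "v \<le> 1" unfolding v_def using w mult_mono[of w 1 "1 - w" 1] by simp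
  moreover have "0 \<le> v" unfolding v_def using w by simp
  ultimately have "\<bar>(\<psi>\<^sup>2 - 1 / 4) / 2 + w * (1 - w) / 2\<bar> \<le> 1"
    unfolding v_def[symmetric] z_def[symmetric] by argo
  then have "real p * \<bar>(\<psi>\<^sup>2 - 1 / 4) / 2 + w * (1 - w) / 2\<bar> \<le> real p * 1" by (intro mult_left_mono) auto
  then show ?thesis using eq unfolding T_def \<psi>_def u_def by (simp add: abs_mult)
qed

text \<open>The quadratic main term of each residue class is the same, so it is killed by the mean
  value zero of the weight, and only the sawtooth terms, which oscillate in \<open>y\<close>, are left.\<close>
lemma abs_sum_mean_zero_weighted:
  fixes s :: "nat \<Rightarrow> real" and y :: real and p N :: nat
  assumes "0 < p" and per: "\<And>n. s (n + p) = s n" and mean: "(\<Sum>j\<in>{1..p}. s j) = 0"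
    and s: "\<And>n. \<bar>s n\<bar> \<le> 1" and "real N \<le> y" and "y < real N + 1"
  shows "\<bar>(\<Sum>n\<in>{1..N}. s n * real n) + y * (\<Sum>j\<in>{1..p}. s j * sawtooth ((y - real j) / real p))\<bar>
    \<le> (real p)\<^sup>2"
proof -
  define A where "A j = (\<Sum>k<(N + p - j) div p. real (p * k + j))" for j
  define E where "E j = A j - (y\<^sup>2 / (2 * real p) - y * sawtooth ((y - real j) / real p))" for j
  have "(\<Sum>j\<in>{1..p}. s j * E j) = (\<Sum>j\<in>{1..p}. s j * A j)
      - (\<Sum>j\<in>{1..p}. s j) * (y\<^sup>2 / (2 * real p)) + y * (\<Sum>j\<in>{1..p}. s j * sawtooth ((y - real j) / real p))"
    unfolding E_def sum_distrib_left sum_distrib_right sum_subtractf[symmetric] sum.distrib[symmetric]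
    by (intro sum.cong) (simp_all add: algebra_simps)
  also have "\<dots> = (\<Sum>n\<in>{1..N}. s n * real n) + y * (\<Sum>j\<in>{1..p}. s j * sawtooth ((y - real j) / real p))"
    using sum_split_residues[where F = s and N = N and h = real, OF \<open>0 < p\<close> per] mean unfolding A_def by simp
  finally have "\<bar>(\<Sum>n\<in>{1..N}. s n * real n) + y * (\<Sum>j\<in>{1..p}. s j * sawtooth ((y - real j) / real p))\<bar>
      = \<bar>\<Sum>j\<in>{1..p}. s j * E j\<bar>" by simp
  also have "\<dots> \<le> (\<Sum>j\<in>{1..p}. 1 * real p)"
  proof (rule order_trans[OF sum_abs], rule sum_mono)
    fix j assume "j \<in> {1..p}"
    then show "\<bar>s j * E j\<bar> \<le> 1 * real p"
      unfolding abs_mult E_def A_def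
      using abs_sum_arith_progression_sawtooth[of j p N y] s assms(5,6) by (intro mult_mono) auto
  qed
  also have "\<dots> = (real p)\<^sup>2" by (simp add: power2_eq_square)
  finally show ?thesis .
qed

section \<open>The divisor sum\<close>

lemma sum_hyperbola:
  fixes f g :: "nat \<Rightarrow> real" and N Z :: nat
  assumes "Z\<^sup>2 \<le> N" and "N < (Z + 1)\<^sup>2"
  shows "(\<Sum>(m, n)\<in>{(m, n). 0 < m \<and> 0 < n \<and> m * n \<le> N}. g m * f n)
    = (\<Sum>m\<in>{1..Z}. g m * (\<Sum>n\<in>{1..N div m}. f n)) + (\<Sum>n\<in>{1..Z}. f n * (\<Sum>m\<in>{1..N div n}. g m))
      - (\<Sum>m\<in>{1..Z}. g m) * (\<Sum>n\<in>{1..Z}. f n)"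
proof -
  define A where "A = (SIGMA m:{1..Z}. {1..N div m})"
  define B where "B = (\<lambda>(n, m). (m, n)) ` (SIGMA n:{1..Z}. {1..N div n})"
  have A: "(m, n) \<in> A \<longleftrightarrow> 0 < m \<and> 0 < n \<and> m * n \<le> N \<and> m \<le> Z" for m n
    unfolding A_def by (auto simp: less_eq_div_iff_mult_less_eq mult.commute)
  have B: "(m, n) \<in> B \<longleftrightarrow> 0 < m \<and> 0 < n \<and> m * n \<le> N \<and> n \<le> Z" for m n
    unfolding B_def by (auto simp: less_eq_div_iff_mult_less_eq mult.commute image_iff)
  have small: "m \<le> Z \<or> n \<le> Z" if "m * n \<le> N" for m n
  proof (rule ccontr)
    assume "\<not> (m \<le> Z \<or> n \<le> Z)"
    then have "(Z + 1) * (Z + 1) \<le> m * n" by (intro mult_mono) auto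
    then show False using that assms(2) by (simp add: power2_eq_square)
  qed
  have prod: "m * n \<le> N" if "m \<le> Z" "n \<le> Z" for m n
    using mult_mono[OF that] assms(1) by (simp add: power2_eq_square)
  have un: "{(m, n). 0 < m \<and> 0 < n \<and> m * n \<le> N} = A \<union> B"
  proof (rule set_eqI, clarify)
    fix m n
    show "(m, n) \<in> {(m, n). 0 < m \<and> 0 < n \<and> m * n \<le> N} \<longleftrightarrow> (m, n) \<in> A \<union> B"
      using A[of m n] B[of m n] small[of m n] by auto
  qed
  have int: "A \<inter> B = {1..Z} \<times> {1..Z}"
    using A B prod by (auto simp: Suc_le_eq)
  have "finite A" "finite B" unfolding A_def B_def by auto
  have sA: "(\<Sum>(m, n)\<in>A. g m * f n) = (\<Sum>m\<in>{1..Z}. g m * (\<Sum>n\<in>{1..N div m}. f n))"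
    unfolding A_def by (simp add: sum.Sigma[symmetric] sum_distrib_left)
  have "inj_on (\<lambda>(n, m). (m, n)) (SIGMA n:{1..Z}. {1..N div n})" by (auto simp: inj_on_def)
  then have "(\<Sum>(m, n)\<in>B. g m * f n) = (\<Sum>(n, m)\<in>(SIGMA n:{1..Z}. {1..N div n}). f n * g m)"
    unfolding B_def by (subst sum.reindex) (auto simp: mult.commute intro!: sum.cong)
  also have "\<dots> = (\<Sum>n\<in>{1..Z}. f n * (\<Sum>m\<in>{1..N div n}. g m))"
    by (simp add: sum.Sigma[symmetric] sum_distrib_left)
  finally have sB: "(\<Sum>(m, n)\<in>B. g m * f n) = (\<Sum>n\<in>{1..Z}. f n * (\<Sum>m\<in>{1..N div n}. g m))" .
  have sAB: "(\<Sum>(m, n)\<in>A \<inter> B. g m * f n) = (\<Sum>m\<in>{1..Z}. g m) * (\<Sum>n\<in>{1..Z}. f n)"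
    unfolding int by (simp add: sum.cartesian_product[symmetric] sum_product)
  show ?thesis
    unfolding un sum_Un[OF \<open>finite A\<close> \<open>finite B\<close>] sA sB sAB ..
qed

text \<open>The reflection \<open>j \<mapsto> p - j\<close> changes the sign of the summand.\<close>
lemma sum_sin_full_period:
  fixes a p :: nat
  assumes "0 < p"
  shows "(\<Sum>j\<in>{1..p}. sin (2 * pi * real j * real a / real p)) = 0"
proof -
  define s where "s j = sin (2 * pi * real j * real a / real p)" for j :: nat
  have refl: "s (p - j) = - s j" if "j < p" for j
  proof -
    have "2 * pi * real (p - j) * real a / real p = 2 * pi * real a - 2 * pi * real j * real a / real p"
      using that \<open>0 < p\<close> by (simp add: of_nat_diff field_simps)
    moreover have "sin (2 * pi * real a) = 0" "cos (2 * pi * real a) = 1"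
      using sin_2npi[of a] cos_2npi[of a] by (simp_all add: mult_ac)
    ultimately show ?thesis unfolding s_def by (simp only: sin_diff)
  qed
  have "s p = 0" using refl[of 0] \<open>0 < p\<close> unfolding s_def by simp
  have "(\<Sum>j\<in>{1..<p}. s j) = (\<Sum>j\<in>{1..<p}. s (p - j))"
    by (rule sum.reindex_bij_witness[where i = "\<lambda>j. p - j" and j = "\<lambda>j. p - j"]) auto
  also have "\<dots> = (\<Sum>j\<in>{1..<p}. - s j)" by (intro sum.cong) (auto simp: refl)
  finally have "(\<Sum>j\<in>{1..<p}. s j) = 0" by (simp add: sum_negf)
  moreover have "{1..p} = insert p {1..<p}" using \<open>0 < p\<close> by auto
  ultimately show ?thesis using \<open>s p = 0\<close> unfolding s_def[symmetric] by simp
qed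

text \<open>On the residue class \<open>m = q k + r\<close> the argument \<open>N / (p m)\<close> becomes \<open>X / (k + r / q)\<close> with
  \<open>X = N / (p q)\<close>, the shape of the sawtooth estimate over the hyperbola.\<close>
lemma abs_sum_periodic_sawtooth_hyperbola:
  fixes t :: "nat \<Rightarrow> real" and \<gamma> :: real and p q N Z :: nat
  assumes "0 < p" and "0 < q" and per: "\<And>m. t (m + q) = t m" and t: "\<And>m. \<bar>t m\<bar> \<le> 1"
    and "p * q \<le> N" and "Z\<^sup>2 \<le> N"
  shows "\<bar>\<Sum>m\<in>{1..Z}. t m * sawtooth (real N / (real p * real m) + \<gamma>)\<bar>
    \<le> 2102 * real p * (real q)\<^sup>2 * real N powr (1 / 3) * (1 + ln (real N))\<^sup>2"
proof -
  define X where "X = real N / (real p * real q)"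
  define Y where "Y = X powr (1 / 3)"
  have "0 < N" using assms(1,2,5) by (metis le_zero_eq mult_is_0 neq0_conv)
  have "real (p * q) \<le> real N" using assms(5) by (rule of_nat_mono)
  then have "1 \<le> X" unfolding X_def using assms(1,2) by simp
  then have "1 \<le> Y" unfolding Y_def by (simp add: ge_one_powr_ge_zero)
  have XY: "X = Y ^ 3" unfolding Y_def using \<open>1 \<le> X\<close> by (simp add: powr_power)
  have YN: "Y \<le> real N powr (1 / 3)"
  proof -
    have "1 * 1 \<le> real p * real q" using assms(1,2) by (intro mult_mono) auto
    then have "real N / (real p * real q) \<le> real N / 1" by (intro divide_left_mono) auto
    then show ?thesis unfolding Y_def X_def by (intro powr_mono2) auto
  qed
  have pq1: "1 \<le> real p * real q"
    using mult_mono[of 1 "real p" 1 "real q"] assms(1,2) by simp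
  have part: "\<bar>\<Sum>k<(Z + q - r) div q. sawtooth (real N / (real p * real (q * k + r)) + \<gamma>)\<bar>
      \<le> 2102 * (real p * real q) * real N powr (1 / 3) * (1 + ln (real N))\<^sup>2" if r: "1 \<le> r" "r \<le> q" for r
  proof -
    define T where "T = (Z + q - r) div q"
    have "T \<le> Z"
    proof (rule ccontr)
      assume "\<not> T \<le> Z"
      then have "(Z + 1) * q \<le> T * q" by (intro mult_right_mono) auto
      also have "T * q \<le> Z + q - r" unfolding T_def by simp
      also have "\<dots> < Z + q" using r by simp
      finally have "Z * q < Z" by simp
      then show False using \<open>0 < q\<close> by simp
    qed
    then have "T\<^sup>2 \<le> N" using assms(6) by (meson le0 order_trans power_mono)
    then have "real (T\<^sup>2) \<le> real N" by (rule of_nat_mono)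
    then have T2: "(real T)\<^sup>2 \<le> (real p * real q) * Y ^ 3"
      unfolding XY[symmetric] X_def using assms(1,2) by simp
    have "T \<le> T\<^sup>2" by (simp add: power2_eq_square)
    then have "T \<le> N" using \<open>T\<^sup>2 \<le> N\<close> by simp
    then have "ln (real T) \<le> ln (real N)" "0 \<le> ln (real T)"
      using \<open>0 < N\<close> by (cases "T = 0"; simp)+
    have arg: "real N / (real p * real (q * k + r)) = X / (real k + real r / real q)" for k
      unfolding X_def using assms(1,2) r by (simp add: field_simps)
    have "\<bar>\<Sum>k<T. sawtooth (X / (real k + real r / real q) + \<gamma>)\<bar>
        \<le> 2102 * (real p * real q) * Y * (1 + ln (real T))\<^sup>2"
      using r \<open>0 < q\<close> T2 \<open>1 \<le> Y\<close> XY pq1 by (intro abs_sum_sawtooth_hyperbola) auto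
    also have "\<dots> \<le> 2102 * (real p * real q) * real N powr (1 / 3) * (1 + ln (real N))\<^sup>2"
      using YN \<open>ln (real T) \<le> ln (real N)\<close> \<open>0 \<le> ln (real T)\<close> \<open>1 \<le> Y\<close>
      by (intro mult_mono power_mono) auto
    finally show ?thesis unfolding arg T_def .
  qed
  have "(\<Sum>m\<in>{1..Z}. t m * sawtooth (real N / (real p * real m) + \<gamma>))
      = (\<Sum>r\<in>{1..q}. t r * (\<Sum>k<(Z + q - r) div q. sawtooth (real N / (real p * real (q * k + r)) + \<gamma>)))"
    by (rule sum_split_residues[where F = t and h = "\<lambda>m. sawtooth (real N / (real p * real m) + \<gamma>)", OF \<open>0 < q\<close> per])
  also have "\<bar>\<dots>\<bar> \<le> (\<Sum>r\<in>{1..q}. 1 * (2102 * (real p * real q) * real N powr (1 / 3) * (1 + ln (real N))\<^sup>2))"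
    by (rule order_trans[OF sum_abs], rule sum_mono, unfold abs_mult, intro mult_mono t part) auto
  also have "\<dots> = 2102 * real p * (real q)\<^sup>2 * real N powr (1 / 3) * (1 + ln (real N))\<^sup>2"
    by (simp add: power2_eq_square)
  finally show ?thesis .
qed

text \<open>The inner sum has \<open>y = N / m\<close> in front of its sawtooth terms, and this factor turns the
  outer weight \<open>m\<close> into the constant \<open>N\<close>. What remains is \<open>N\<close> times an unweighted sawtooth sum
  over \<open>m \<le> \<surd>N\<close>; the bounded errors of the inner sums add up to
  \<open>O(Z\<^sup>2) = O(N)\<close>.\<close>
lemma abs_half_hyperbola_le:
  fixes s t :: "nat \<Rightarrow> real" and p q N Z :: nat
  assumes "0 < p" and "0 < q" and sper: "\<And>n. s (n + p) = s n" and tper: "\<And>m. t (m + q) = t m"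
    and mean: "(\<Sum>j\<in>{1..p}. s j) = 0" and s: "\<And>n. \<bar>s n\<bar> \<le> 1" and t: "\<And>m. \<bar>t m\<bar> \<le> 1"
    and "p * q \<le> N" and "Z\<^sup>2 \<le> N"
  shows "\<bar>\<Sum>m\<in>{1..Z}. t m * real m * (\<Sum>n\<in>{1..N div m}. s n * real n)\<bar>
    \<le> 2103 * (real p * real q)\<^sup>2 * real N powr (4 / 3) * (1 + ln (real N))\<^sup>2"
proof -
  define L where "L = (1 + ln (real N))\<^sup>2"
  define w where "w m j = sawtooth ((real N / real m - real j) / real p)" for m j :: nat
  define E where "E m = (\<Sum>n\<in>{1..N div m}. s n * real n) + real N / real m * (\<Sum>j\<in>{1..p}. s j * w m j)" for m
  have "0 < N" using assms(1,2,8) by (metis le_zero_eq mult_is_0 neq0_conv)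
  then have "0 \<le> ln (real N)" by simp
  then have "1 \<le> L" unfolding L_def by simp
  have E: "\<bar>E m\<bar> \<le> (real p)\<^sup>2" if "1 \<le> m" for m
    unfolding E_def w_def
  proof (rule abs_sum_mean_zero_weighted[where s = s, OF assms(1) sper mean s])
    have "real (N div m) = of_int \<lfloor>real N / real m\<rfloor>" by (simp add: floor_divide_of_nat_eq)
    then show "real (N div m) \<le> real N / real m" "real N / real m < real (N div m) + 1" by linarith+
  qed
  have "(\<Sum>m\<in>{1..Z}. t m * real m * (\<Sum>n\<in>{1..N div m}. s n * real n))
      = (\<Sum>m\<in>{1..Z}. t m * real m * E m - real N * (\<Sum>j\<in>{1..p}. s j * (t m * w m j)))"
  proof (rule sum.cong)
    fix m assume "m \<in> {1..Z}"
    then have "real m \<noteq> 0" by simp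
    then have "t m * real m * (real N / real m * (\<Sum>j\<in>{1..p}. s j * w m j))
        = real N * (t m * (\<Sum>j\<in>{1..p}. s j * w m j))" by simp
    also have "\<dots> = real N * (\<Sum>j\<in>{1..p}. s j * (t m * w m j))"
      unfolding sum_distrib_left[of "t m"] by (simp add: mult.left_commute)
    finally show "t m * real m * (\<Sum>n\<in>{1..N div m}. s n * real n)
        = t m * real m * E m - real N * (\<Sum>j\<in>{1..p}. s j * (t m * w m j))"
      unfolding E_def distrib_left by simp
  qed simp
  also have "\<dots> = (\<Sum>m\<in>{1..Z}. t m * real m * E m) - real N * (\<Sum>j\<in>{1..p}. s j * (\<Sum>m\<in>{1..Z}. t m * w m j))"
    unfolding sum_subtractf sum_distrib_left[of "real N", symmetric]
    by (subst sum.swap) (simp add: sum_distrib_left)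
  finally have split: "(\<Sum>m\<in>{1..Z}. t m * real m * (\<Sum>n\<in>{1..N div m}. s n * real n))
      = (\<Sum>m\<in>{1..Z}. t m * real m * E m) - real N * (\<Sum>j\<in>{1..p}. s j * (\<Sum>m\<in>{1..Z}. t m * w m j))" .
  have "\<bar>\<Sum>m\<in>{1..Z}. t m * real m * E m\<bar> \<le> (\<Sum>m\<in>{1..Z}. 1 * real Z * (real p)\<^sup>2)"
    by (rule order_trans[OF sum_abs], rule sum_mono, unfold abs_mult, intro mult_mono t E) auto
  also have "\<dots> = real (Z\<^sup>2) * (real p)\<^sup>2" by (simp add: power2_eq_square)
  also have "\<dots> \<le> real N * (real p)\<^sup>2" using assms(9) by (intro mult_right_mono of_nat_mono) auto
  finally have err: "\<bar>\<Sum>m\<in>{1..Z}. t m * real m * E m\<bar> \<le> real N * (real p)\<^sup>2" .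
  define B where "B = 2102 * real p * (real q)\<^sup>2 * real N powr (1 / 3) * L"
  have "\<bar>\<Sum>j\<in>{1..p}. s j * (\<Sum>m\<in>{1..Z}. t m * w m j)\<bar> \<le> (\<Sum>j\<in>{1..p}. 1 * B)"
  proof (rule order_trans[OF sum_abs], rule sum_mono)
    fix j
    have "w m j = sawtooth (real N / (real p * real m) + (- real j / real p))" for m
      unfolding w_def by (simp add: diff_divide_distrib mult.commute)
    then have "\<bar>\<Sum>m\<in>{1..Z}. t m * w m j\<bar> \<le> B" unfolding B_def L_def
      using abs_sum_periodic_sawtooth_hyperbola[where t = t, OF assms(1,2) tper t assms(8,9), of "- real j / real p"]
      by simp
    then show "\<bar>s j * (\<Sum>m\<in>{1..Z}. t m * w m j)\<bar> \<le> 1 * B"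
      unfolding abs_mult using s by (intro mult_mono) auto
  qed
  then have "\<bar>\<Sum>j\<in>{1..p}. s j * (\<Sum>m\<in>{1..Z}. t m * w m j)\<bar> \<le> real p * B" by simp
  then have "\<bar>real N * (\<Sum>j\<in>{1..p}. s j * (\<Sum>m\<in>{1..Z}. t m * w m j))\<bar> \<le> real N * (real p * B)"
    unfolding abs_mult by (simp add: mult_left_mono)
  also have "\<dots> = 2102 * ((real p * real q)\<^sup>2 * (real N powr (1 / 3) * real N) * L)"
    unfolding B_def by (simp add: power2_eq_square)
  also have N43: "real N powr (1 / 3) * real N = real N powr (4 / 3)"
    using \<open>0 < N\<close> powr_add[of "real N" "1 / 3" 1] by simp
  finally have main: "\<bar>real N * (\<Sum>j\<in>{1..p}. s j * (\<Sum>m\<in>{1..Z}. t m * w m j))\<bar>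
      \<le> 2102 * ((real p * real q)\<^sup>2 * real N powr (4 / 3) * L)" .
  have "real N * (real p)\<^sup>2 \<le> (real p * real q)\<^sup>2 * real N powr (4 / 3) * L"
  proof -
    have "1 \<le> real N powr (1 / 3)" using \<open>0 < N\<close> by (simp add: ge_one_powr_ge_zero)
    then have "1 * real N \<le> real N powr (4 / 3)" unfolding N43[symmetric] by (intro mult_right_mono) auto
    moreover have "(real p)\<^sup>2 \<le> (real p * real q)\<^sup>2" using \<open>0 < q\<close> mult_left_mono[of 1 "real q" "real p"]
      by (intro power_mono) auto
    ultimately have "(real p)\<^sup>2 * (1 * real N) * 1 \<le> (real p * real q)\<^sup>2 * real N powr (4 / 3) * L"
      using \<open>1 \<le> L\<close> by (intro mult_mono) auto
    then show ?thesis by (simp add: mult.commute)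
  qed
  then have "\<bar>\<Sum>m\<in>{1..Z}. t m * real m * (\<Sum>n\<in>{1..N div m}. s n * real n)\<bar>
      \<le> 2103 * ((real p * real q)\<^sup>2 * real N powr (4 / 3) * L)"
    unfolding split using err main by argo
  then show ?thesis unfolding L_def by (simp add: mult.assoc)
qed

lemma abs_sum_mean_zero_weighted_le:
  fixes s :: "nat \<Rightarrow> real" and p N :: nat
  assumes "0 < p" and per: "\<And>n. s (n + p) = s n" and mean: "(\<Sum>j\<in>{1..p}. s j) = 0"
    and s: "\<And>n. \<bar>s n\<bar> \<le> 1"
  shows "\<bar>\<Sum>n\<in>{1..N}. s n * real n\<bar> \<le> 2 * (real p)\<^sup>2 * real N"
proof (cases "N = 0")
  case False
  define G where "G = (\<Sum>j\<in>{1..p}. s j * sawtooth ((real N - real j) / real p))"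
  have "\<bar>G\<bar> \<le> (\<Sum>j\<in>{1..p}. 1 * 1)" unfolding G_def
  proof (rule order_trans[OF sum_abs], rule sum_mono)
    fix j
    have "\<bar>sawtooth ((real N - real j) / real p)\<bar> \<le> 1"
      using abs_sawtooth_le[of "(real N - real j) / real p"] by linarith
    then show "\<bar>s j * sawtooth ((real N - real j) / real p)\<bar> \<le> 1 * 1"
      unfolding abs_mult using s by (intro mult_mono) auto
  qed
  also have "\<dots> = real p" by simp
  also have "real p \<le> (real p)\<^sup>2" using \<open>0 < p\<close> by (simp add: power2_eq_square)
  finally have "\<bar>real N * G\<bar> \<le> real N * (real p)\<^sup>2" unfolding abs_mult by (simp add: mult_left_mono)
  moreover have "\<bar>(\<Sum>n\<in>{1..N}. s n * real n) + real N * G\<bar> \<le> (real p)\<^sup>2"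
    unfolding G_def using assms by (intro abs_sum_mean_zero_weighted) auto
  moreover have "(real p)\<^sup>2 \<le> real N * (real p)\<^sup>2"
    using False mult_right_mono[of 1 "real N" "(real p)\<^sup>2"] by simp
  moreover have "\<bar>z\<bar> \<le> 2 * c" if "\<bar>v\<bar> \<le> c" "\<bar>z + v\<bar> \<le> d" "d \<le> c" for z v c d :: real
    using that by linarith
  ultimately have "\<bar>\<Sum>n\<in>{1..N}. s n * real n\<bar> \<le> 2 * (real N * (real p)\<^sup>2)" by blast
  then show ?thesis by (simp add: mult_ac)
qed simp

text \<open>In the hyperbola method the two halves are estimated in the same way. The product that is
  subtracted is harmless: both of its factors are \<open>O(Z)\<close>, since both weights have mean value
  zero.\<close>
lemma abs_sum_mean_zero_divisor_le:
  fixes s t :: "nat \<Rightarrow> real" and p q N :: nat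
  assumes "0 < p" and "0 < q" and sper: "\<And>n. s (n + p) = s n" and tper: "\<And>m. t (m + q) = t m"
    and smean: "(\<Sum>j\<in>{1..p}. s j) = 0" and tmean: "(\<Sum>j\<in>{1..q}. t j) = 0"
    and s: "\<And>n. \<bar>s n\<bar> \<le> 1" and t: "\<And>m. \<bar>t m\<bar> \<le> 1" and "p * q \<le> N"
  shows "\<bar>\<Sum>(m, n)\<in>{(m, n). 0 < m \<and> 0 < n \<and> m * n \<le> N}. (t m * real m) * (s n * real n)\<bar>
    \<le> 4210 * (real p * real q)\<^sup>2 * real N powr (4 / 3) * (1 + ln (real N))\<^sup>2"
proof -
  define Z where "Z = floor_sqrt N"
  define B where "B = (real p * real q)\<^sup>2 * real N powr (4 / 3) * (1 + ln (real N))\<^sup>2"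
  have Z: "Z\<^sup>2 \<le> N" "N < (Z + 1)\<^sup>2"
    unfolding Z_def using Suc_floor_sqrt_power2_gt[of N] by simp_all
  have "0 < N" using assms(1,2,9) by (metis le_zero_eq mult_is_0 neq0_conv)
  have 1: "\<bar>\<Sum>m\<in>{1..Z}. t m * real m * (\<Sum>n\<in>{1..N div m}. s n * real n)\<bar> \<le> 2103 * B"
    using abs_half_hyperbola_le[where s = s and t = t, OF assms(1,2) sper tper smean s t assms(9) Z(1)]
    unfolding B_def by (simp add: mult.assoc)
  have "q * p \<le> N" using assms(9) by (simp add: mult.commute)
  then have 2: "\<bar>\<Sum>n\<in>{1..Z}. s n * real n * (\<Sum>m\<in>{1..N div n}. t m * real m)\<bar> \<le> 2103 * B"
    using abs_half_hyperbola_le[where s = t and t = s, OF assms(2,1) tper sper tmean t s _ Z(1)]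
    unfolding B_def by (simp add: mult.assoc mult.commute[of "real q"])
  have "\<bar>(\<Sum>m\<in>{1..Z}. t m * real m) * (\<Sum>n\<in>{1..Z}. s n * real n)\<bar>
      \<le> (2 * (real q)\<^sup>2 * real Z) * (2 * (real p)\<^sup>2 * real Z)"
    unfolding abs_mult using assms by (intro mult_mono abs_sum_mean_zero_weighted_le) auto
  also have "\<dots> = 4 * ((real p * real q)\<^sup>2 * real (Z\<^sup>2))" by (simp add: power2_eq_square)
  also have "\<dots> \<le> 4 * B"
  proof -
    have "real (Z\<^sup>2) \<le> real N" using Z(1) by (rule of_nat_mono)
    also have "real N = real N powr 1" using \<open>0 < N\<close> by simp
    also have "\<dots> \<le> real N powr (4 / 3)" using \<open>0 < N\<close> by (intro powr_mono) auto
    finally have "(real p * real q)\<^sup>2 * real (Z\<^sup>2) * 1 \<le> B"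
      unfolding B_def using \<open>0 < N\<close> by (intro mult_mono mult_left_mono) auto
    then show ?thesis by simp
  qed
  finally have 3: "\<bar>(\<Sum>m\<in>{1..Z}. t m * real m) * (\<Sum>n\<in>{1..Z}. s n * real n)\<bar> \<le> 4 * B" .
  show ?thesis
    unfolding sum_hyperbola[of Z N "\<lambda>m. t m * real m" "\<lambda>n. s n * real n", OF Z]
    using 1 2 3 unfolding B_def by (simp add: mult.assoc)
qed

text \<open>The weight \<open>1/2\<close> on \<open>m n = x\<close> averages the sums over \<open>m n \<le> x\<close> and \<open>m n < x\<close>, and both are
  sums up to an integer. Estimating the boundary terms this way avoids any bound for the
  number of divisors.\<close>
lemma SS_eq_average:
  assumes "1 \<le> x"
  shows "SS a b p q x =
    ((\<Sum>(m, n)\<in>{(m, n). 0 < m \<and> 0 < n \<and> m * n \<le> nat \<lfloor>x\<rfloor>}.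
        (sin (2 * pi * real m * real b / real q) * real m) * (sin (2 * pi * real n * real a / real p) * real n))
    + (\<Sum>(m, n)\<in>{(m, n). 0 < m \<and> 0 < n \<and> m * n \<le> nat (\<lceil>x\<rceil> - 1)}.
        (sin (2 * pi * real m * real b / real q) * real m) * (sin (2 * pi * real n * real a / real p) * real n))) / 2"
proof -
  define F where "F = (\<lambda>(m, n). (sin (2 * pi * real m * real b / real q) * real m)
    * (sin (2 * pi * real n * real a / real p) * real n))"
  define P where "P = {(m, n). 0 < m \<and> 0 < n \<and> real (m * n) \<le> x}"
  define P' where "P' = {mn \<in> P. real (fst mn * snd mn) < x}"
  have "finite P" unfolding P_def by (rule finite_SS_index)
  have le: "k \<le> nat \<lfloor>x\<rfloor> \<longleftrightarrow> real k \<le> x" for k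
    using \<open>1 \<le> x\<close> by (simp add: le_nat_iff le_floor_iff)
  have less: "k \<le> nat (\<lceil>x\<rceil> - 1) \<longleftrightarrow> real k < x" for k
  proof -
    have "0 \<le> \<lceil>x\<rceil> - 1" using \<open>1 \<le> x\<close> by linarith
    then have "k \<le> nat (\<lceil>x\<rceil> - 1) \<longleftrightarrow> int k < \<lceil>x\<rceil>" by (simp add: le_nat_iff)
    then show ?thesis by (simp add: less_ceiling_iff)
  qed
  have P: "{(m, n). 0 < m \<and> 0 < n \<and> m * n \<le> nat \<lfloor>x\<rfloor>} = P"
    unfolding P_def le ..
  have P': "{(m, n). 0 < m \<and> 0 < n \<and> m * n \<le> nat (\<lceil>x\<rceil> - 1)} = P'"
    unfolding P'_def P_def less by (auto simp del: of_nat_mult)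
  have "SS a b p q x = (\<Sum>mn\<in>P. (F mn + (if real (fst mn * snd mn) < x then F mn else 0)) / 2)"
    unfolding SS_def P_def[symmetric]
  proof (rule sum.cong)
    fix mn assume "mn \<in> P"
    then obtain m n where mn: "mn = (m, n)" "real (m * n) \<le> x" unfolding P_def by auto
    show "(case mn of (m, n) \<Rightarrow> (if real (m * n) = x then 1 / 2 else 1) *
          (real m * real n * sin (2 * pi * real n * real a / real p) * sin (2 * pi * real m * real b / real q)))
        = (F mn + (if real (fst mn * snd mn) < x then F mn else 0)) / 2"
      using mn(2) unfolding mn(1) F_def by (auto simp: mult_ac simp del: of_nat_mult)
  qed simp
  also have "\<dots> = ((\<Sum>mn\<in>P. F mn) + (\<Sum>mn\<in>P'. F mn)) / 2"
    unfolding sum_divide_distrib[symmetric] sum.distrib P'_def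
    using \<open>finite P\<close> by (simp add: sum.inter_filter)
  finally show ?thesis unfolding P P' F_def .
qed

theorem theorem9p4:
  fixes a b p q :: nat and \<epsilon> :: real
  assumes "0 < a" and "0 < b" and "0 < p" and "0 < q"
    and "coprime a p" and "coprime b q"
    and "0 < \<epsilon>"
  shows "SS a b p q \<in> O[at_top](\<lambda>x. x powr (4 / 3 + \<epsilon>))"
proof -
  define s where "s n = sin (2 * pi * real n * real a / real p)" for n :: nat
  define t where "t m = sin (2 * pi * real m * real b / real q)" for m :: nat
  have periodic: "sin (2 * pi * real (n + r) * real c / real r) = sin (2 * pi * real n * real c / real r)"
    if "0 < r" for n c r :: nat
  proof -
    have "2 * pi * real (n + r) * real c / real r = 2 * pi * real n * real c / real r + 2 * real c * pi"
      using that by (simp add: field_simps)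
    then show ?thesis by (simp only: sin_add sin_2npi cos_2npi)
  qed
  define D where "D N = (\<Sum>(m, n)\<in>{(m, n). 0 < m \<and> 0 < n \<and> m * n \<le> N}. (t m * real m) * (s n * real n))"
    for N :: nat
  define K where "K = 4210 * (real p * real q)\<^sup>2"
  have D_le: "\<bar>D N\<bar>
      \<le> K * (x powr (4 / 3) * (1 + ln x)\<^sup>2)" if "p * q \<le> N" "real N \<le> x" for N x
  proof -
    have "0 < N" using assms(3,4) that(1) by (metis le_zero_eq mult_is_0 neq0_conv)
    have "\<bar>D N\<bar>
        \<le> K * real N powr (4 / 3) * (1 + ln (real N))\<^sup>2"
      unfolding K_def D_def
      by (rule abs_sum_mean_zero_divisor_le)
         (use assms that periodic sum_sin_full_period[of p a] sum_sin_full_period[of q b]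
           in \<open>auto simp del: of_nat_add simp: s_def t_def\<close>)
    also have "\<dots> \<le> K * x powr (4 / 3) * (1 + ln x)\<^sup>2"
      using \<open>0 < N\<close> that(2) unfolding K_def by (intro mult_mono powr_mono2 power_mono) auto
    finally show ?thesis by (simp add: mult.assoc)
  qed
  have "SS a b p q \<in> O[at_top](\<lambda>x. x powr (4 / 3) * (1 + ln x)\<^sup>2)"
  proof (rule bigoI)
    show "\<forall>\<^sub>F x in at_top. norm (SS a b p q x) \<le> K * norm (x powr (4 / 3) * (1 + ln x)\<^sup>2)"
      using eventually_ge_at_top[of "real (p * q) + 1"]
    proof eventually_elim
      case (elim x)
      have "1 \<le> x" using elim by linarith
      have "int (p * q) \<le> \<lfloor>x\<rfloor>" "int (p * q) \<le> \<lceil>x\<rceil> - 1" using elim by linarith+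
      then have "p * q \<le> nat \<lfloor>x\<rfloor>" "p * q \<le> nat (\<lceil>x\<rceil> - 1)" by linarith+
      moreover have "real (nat \<lfloor>x\<rfloor>) \<le> x" "real (nat (\<lceil>x\<rceil> - 1)) \<le> x" using \<open>1 \<le> x\<close> by linarith+
      ultimately have "\<bar>D (nat \<lfloor>x\<rfloor>)\<bar> \<le> K * (x powr (4 / 3) * (1 + ln x)\<^sup>2)"
        "\<bar>D (nat (\<lceil>x\<rceil> - 1))\<bar> \<le> K * (x powr (4 / 3) * (1 + ln x)\<^sup>2)"
        using D_le by blast+
      moreover have "SS a b p q x = (D (nat \<lfloor>x\<rfloor>) + D (nat (\<lceil>x\<rceil> - 1))) / 2"
        unfolding D_def s_def t_def using SS_eq_average[OF \<open>1 \<le> x\<close>] .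
      moreover have "\<bar>(v + w) / 2\<bar> \<le> c" if "\<bar>v\<bar> \<le> c" "\<bar>w\<bar> \<le> c" for v w c :: real
        using that by argo
      ultimately show ?case by simp
    qed
  qed
  also have "(\<lambda>x. x powr (4 / 3) * (1 + ln x)\<^sup>2) \<in> O[at_top](\<lambda>x :: real. x powr (4 / 3 + \<epsilon>))"
    using \<open>0 < \<epsilon>\<close> by real_asymp
  finally show ?thesis .
qed

end
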